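(* Let $\widetilde{m}\in\{0,1\}^d$ have exactly $k$ nonzero components, let $\lambda>0$, and let $\mathcal{L}:\mathbb{R}^d\to\mathbb{R}$ be differentiable at $\widetilde{m}$ with $\|\nabla\mathcal{L}(\widetilde{m})\|_\infty\le\lambda$. Let $\mathtt{R}(m)=\|m\|_1$ and let $$m^\star\in\operatorname*{argmin}_{m\in[0,1]^d}\ \mathcal{L}(m)+\lambda\,\mathtt{R}(m).$$ Assume that there exists $\gamma>0$ such that $$\mathcal{L}(m^\star)\ \ge\ \mathcal{L}(\widetilde{m})+\nabla\mathcal{L}(\widetilde{m})^T(m^\star-\widetilde{m})+\frac{\gamma}{2}\|m^\star-\widetilde{m}\|_2^2 .$$ Let $h=m^\star-\widetilde{m}$. Then $$\|h\|_2\le\frac{4\lambda\sqrt{k}}{\gamma}.$$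
   Context: Here $\mathcal{L}(m)$ stands for the loss $\mathcal{L}(x;m\odot\theta)$ of a model with fixed input data $x$ and fixed trained parameter vector $\theta\in\mathbb{R}^d$, seen as a function of the mask $m$ only; $\odot$ is the componentwise product. The vector $\widetilde{m}$ is the (unknown) target binary mask, $m^\star$ is its estimate, and $\mathtt{R}$ is the regularizer. The norms are $\|v\|_1=\sum_i|v_i|$, $\|v\|_2=(\sum_i v_i^2)^{1/2}$, $\|v\|_\infty=\max_i|v_i|$. *)

theory Defs
  imports "HOL-Analysis.Analysis"
begin

definition l1_norm :: "real ^ 'd \<Rightarrow> real" where
  "l1_norm v = (\<Sum>i\<in>UNIV. \<bar>v $ i\<bar>)"

end

theory Submission
  imports Defs
begin

text \<open>
  Put \<open>h = m_star - m_target\<close>. Comparing the objective at \<open>m_star\<close> and \<open>m_target\<close>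
  and inserting the strong convexity bound gives
  \<open>\<gamma>/2 * \<parallel>h\<parallel>\<^sup>2 \<le> (\<Sum>i. lam * (\<bar>m_target $ i\<bar> - \<bar>m_star $ i\<bar>) - grad $ i * h $ i)\<close>.
  Off the support of \<open>m_target\<close> each summand is nonpositive, because \<open>lam\<close> dominates the gradient;
  on the support it is at most \<open>2 * lam * \<bar>h $ i\<bar>\<close>, and Cauchy-Schwarz over the \<open>k\<close> support
  coordinates yields \<open>\<gamma>/2 * \<parallel>h\<parallel>\<^sup>2 \<le> 2 * lam * sqrt k * \<parallel>h\<parallel>\<close>.
\<close>

text \<open>Cauchy-Schwarz against the constant 1 on \<open>S\<close>; passing from \<open>S\<close>
  to all coordinates only adds squares.\<close>

lemma sum_abs_nth_le_sqrt_card_mult_norm: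
  fixes v :: "real ^ 'd"
  shows "(\<Sum>i\<in>S. \<bar>v $ i\<bar>) \<le> sqrt (card S) * norm v"
proof -
  have "(\<Sum>i\<in>S. \<bar>1\<bar> * \<bar>v $ i\<bar>) \<le> L2_set (\<lambda>i. 1) S * L2_set (\<lambda>i. v $ i) S"
    by (rule L2_set_mult_ineq)
  also have "L2_set (\<lambda>i. 1) S = sqrt (card S)"
    by (simp add: L2_set_def)
  also have "L2_set (\<lambda>i. v $ i) S \<le> norm v"
    by (auto simp: norm_vec_def L2_set_def intro!: sum_mono2)
  finally show ?thesis
    by (simp add: mult_left_mono)
qed

lemma sum_l1_decrease_le:
  fixes u v g :: "real ^ 'd"
  assumes "infnorm g \<le> lam"
  shows "(\<Sum>i\<in>UNIV. lam * (\<bar>u $ i\<bar> - \<bar>v $ i\<bar>) - g $ i * (v - u) $ i)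
      \<le> 2 * lam * (\<Sum>i | u $ i \<noteq> 0. \<bar>(v - u) $ i\<bar>)"
proof -
  have lam: "0 \<le> lam"
    using assms infnorm_pos_le[of g] by linarith
  have summand: "lam * (\<bar>u $ i\<bar> - \<bar>v $ i\<bar>) - g $ i * (v - u) $ i
      \<le> (if u $ i \<noteq> 0 then 2 * lam * \<bar>(v - u) $ i\<bar> else 0)" for i
  proof -
    have "\<bar>g $ i\<bar> \<le> lam"
      using component_le_infnorm_cart[of g i] assms by linarith
    then have "\<bar>g $ i\<bar> * \<bar>(v - u) $ i\<bar> \<le> lam * \<bar>(v - u) $ i\<bar>"
      by (rule mult_right_mono) simp
    then have "- (g $ i * (v - u) $ i) \<le> lam * \<bar>(v - u) $ i\<bar>"
      by (metis abs_ge_minus_self abs_mult order_trans)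
    moreover have "lam * (\<bar>u $ i\<bar> - \<bar>v $ i\<bar>) \<le> lam * \<bar>(v - u) $ i\<bar>"
      using lam by (intro mult_left_mono) auto
    \<comment> \<open>On the support the two bounds add up, hence the factor 2. Where
      \<open>u $ i = 0\<close>, the l1 term is exactly
      \<open>- lam * \<bar>(v - u) $ i\<bar>\<close> and absorbs the gradient term.\<close>
    ultimately show ?thesis
      by auto
  qed
  have "(\<Sum>i\<in>UNIV. lam * (\<bar>u $ i\<bar> - \<bar>v $ i\<bar>) - g $ i * (v - u) $ i)
      \<le> (\<Sum>i\<in>UNIV. if u $ i \<noteq> 0 then 2 * lam * \<bar>(v - u) $ i\<bar> else 0)"
    by (rule sum_mono) (rule summand)
  also have "\<dots> = 2 * lam * (\<Sum>i | u $ i \<noteq> 0. \<bar>(v - u) $ i\<bar>)"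
    by (simp add: sum.If_cases sum_distrib_left Collect_neg_eq)
  finally show ?thesis .
qed

theorem theorem1:
  fixes L :: "real ^ 'd \<Rightarrow> real"
    and m_target m_star grad :: "real ^ 'd"
    and k :: nat
    and lam \<gamma> :: real
  assumes target_binary: "\<forall>i. m_target $ i \<in> {0, 1}"
    and target_sparsity: "card {i. m_target $ i \<noteq> 0} = k"
    and lam_pos: "lam > 0"
    and gradient: "GDERIV L m_target :> grad"
    and gradient_bound: "infnorm grad \<le> lam"
    and minimizer: "is_arg_min (\<lambda>m. L m + lam * l1_norm m) (\<lambda>m. \<forall>i. m $ i \<in> {0..1}) m_star"
    and gamma_pos: "\<gamma> > 0"
    and strong_convexity:
      "L m_star \<ge> L m_target + grad \<bullet> (m_star - m_target)
                    + \<gamma> / 2 * (norm (m_star - m_target))\<^sup>2"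
  shows "norm (m_star - m_target) \<le> 4 * lam * sqrt (real k) / \<gamma>"
proof -
  define h where "h = m_star - m_target"
  \<comment> \<open>A binary mask is feasible for the relaxed problem, so minimality applies to
    it.\<close>
  have "\<forall>i. m_target $ i \<in> {0..1}"
    using target_binary by (metis atLeastAtMost_iff insertE order_refl singletonD zero_le_one)
  then have "L m_star + lam * l1_norm m_star \<le> L m_target + lam * l1_norm m_target"
    using minimizer by (auto simp: is_arg_min_linorder)
  then have "\<gamma> / 2 * (norm h)\<^sup>2 \<le> lam * l1_norm m_target - lam * l1_norm m_star - grad \<bullet> h"
    using strong_convexity by (simp add: h_def)
  also have "\<dots> = (\<Sum>i\<in>UNIV. lam * (\<bar>m_target $ i\<bar> - \<bar>m_star $ i\<bar>) - grad $ i * h $ i)"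
    by (simp add: l1_norm_def inner_vec_def sum_subtractf sum_distrib_left right_diff_distrib)
  also have "\<dots> \<le> 2 * lam * (\<Sum>i | m_target $ i \<noteq> 0. \<bar>h $ i\<bar>)"
    unfolding h_def using gradient_bound by (rule sum_l1_decrease_le)
  also have "\<dots> \<le> 2 * lam * (sqrt (real k) * norm h)"
    using sum_abs_nth_le_sqrt_card_mult_norm[of h "{i. m_target $ i \<noteq> 0}"] lam_pos
    by (simp add: target_sparsity)
  finally have "(norm h * \<gamma>) * norm h \<le> (4 * lam * sqrt (real k)) * norm h"
    by (simp add: power2_eq_square mult_ac)
  \<comment> \<open>Cancelling \<open>norm h\<close> requires \<open>h\<close> nonzero; for
    \<open>h = 0\<close> the right side is nonnegative.\<close>
  then have "norm h * \<gamma> \<le> 4 * lam * sqrt (real k)"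
    using lam_pos by (cases "h = 0") (simp_all add: mult_ac)
  then show ?thesis
    using gamma_pos by (simp add: h_def pos_le_divide_eq)
qed

end
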